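(* Let $\mathfrak n\in\{ck,cs,cs^\ast,cp,cn,0\}$. If $X$ is an $\mathfrak n$-$\sigma$-space, then $\mathfrak n_\chi(X)\le\aleph_0$.
   Context: All topological spaces are Hausdorff. Let $\mathcal N$ be a family of subsets of a space $X$ and $x\in X$. $\mathcal N$ is, at $x$: - a $0$-network (simply, a network) if for each neighborhood $O_x$ of $x$ there is $N\in\mathcal N$ with $x\in N\subset O_x$; - a $cn$-network if for each neighborhood $O_x$ of $x$ the set $\bigcup\{N\in\mathcal N: x\in N\subset O_x\}$ is a neighborhood of $x$; - a $ck$-network if for any neighborhood $O_x$ of $x$ there is a neighborhood $U_x$ of $x$ such that for each compact $K\subset U_x$ there is a finite $\mathcal F\subset\mathcal N$ with $x\in\bigcap\mathcal F$ and $K\subset\bigcup\mathcal F\subset O_x$; - a $cs$-network if for each sequence $(x_n)_{n\in\mathbb N}$ in $X$ converging to $x$ and each neighborhood $O_x$ of $x$ there are $N\in\mathcal N$ and $k\in\mathbb N$ with $\{x\}\cup\{x_n:n\ge k\}\subset N\subset O_x$; - a $cs^\ast$-network if for each sequence $(x_n)_{n\in\mathbb N}$ in $X$ converging to $x$ and each neighborhood $O_x$ of $x$ there is $N\in\mathcal N$ with $x\in N\subset O_x$ and $\{n: x_n\in N\}$ infinite; - a $cp$-network if either $x$ is isolated in $X$ and $\{x\}\in\mathcal N$, or for each $A\subset X$ with $x\in\overline A\setminus A$ and each neighborhood $O_x$ of $x$ there is $N\in\mathcal N$ with $x\in N\subset O_x$ and $N\cap A$ infinite. $\mathcal N$ is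 an $\mathfrak n$-network in $X$ if it is an $\mathfrak n$-network at each point of $X$. A family is $\sigma$-locally finite if it is a countable union of locally finite families. $X$ is an $\mathfrak n$-$\sigma$-space if it is regular and has a $\sigma$-locally finite $\mathfrak n$-network. $\mathfrak n_\chi(X,x)$ is the smallest cardinality of an $\mathfrak n$-network at $x$, and $\mathfrak n_\chi(X)=\sup\{\mathfrak n_\chi(X,x): x\in X\}$. A $\mathfrak{P}$-space is a $cp$-$\sigma$-space, and the strong Pytkeev property means $cp_\chi(X)\le\aleph_0$. *)

theory Defs
  imports "HOL-Analysis.Analysis"
begin

unbundle cardinal_syntax

text \<open>Neighbourhoods are not required to be open.\<close>

definition neighbourhood_in :: "'a topology \<Rightarrow> 'a \<Rightarrow> 'a set \<Rightarrow> bool" where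
  "neighbourhood_in X x V \<longleftrightarrow>
     V \<subseteq> topspace X \<and> (\<exists>U. openin X U \<and> x \<in> U \<and> U \<subseteq> V)"

definition zero_network_at :: "'a topology \<Rightarrow> 'a \<Rightarrow> 'a set set \<Rightarrow> bool" where
  "zero_network_at X x \<N> \<longleftrightarrow>
     (\<forall>V. neighbourhood_in X x V \<longrightarrow> (\<exists>N\<in>\<N>. x \<in> N \<and> N \<subseteq> V))"

definition cn_network_at :: "'a topology \<Rightarrow> 'a \<Rightarrow> 'a set set \<Rightarrow> bool" where
  "cn_network_at X x \<N> \<longleftrightarrow>
     (\<forall>V. neighbourhood_in X x V \<longrightarrow>
        neighbourhood_in X x (\<Union>{N \<in> \<N>. x \<in> N \<and> N \<subseteq> V}))"

definition ck_network_at :: "'a topology \<Rightarrow> 'a \<Rightarrow> 'a set set \<Rightarrow> bool" where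
  "ck_network_at X x \<N> \<longleftrightarrow>
     (\<forall>V. neighbourhood_in X x V \<longrightarrow>
        (\<exists>U. neighbourhood_in X x U \<and>
           (\<forall>K. compactin X K \<and> K \<subseteq> U \<longrightarrow>
              (\<exists>\<F>. finite \<F> \<and> \<F> \<subseteq> \<N> \<and> x \<in> \<Inter>\<F> \<and> K \<subseteq> \<Union>\<F> \<and> \<Union>\<F> \<subseteq> V))))"

definition cs_network_at :: "'a topology \<Rightarrow> 'a \<Rightarrow> 'a set set \<Rightarrow> bool" where
  "cs_network_at X x \<N> \<longleftrightarrow>
     (\<forall>(s :: nat \<Rightarrow> 'a) V.
        range s \<subseteq> topspace X \<and> limitin X s x sequentially \<and> neighbourhood_in X x V \<longrightarrow>
        (\<exists>N\<in>\<N>. \<exists>k. {x} \<union> {s n |n. n \<ge> k} \<subseteq> N \<and> N \<subseteq> V))"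

definition cs_star_network_at :: "'a topology \<Rightarrow> 'a \<Rightarrow> 'a set set \<Rightarrow> bool" where
  "cs_star_network_at X x \<N> \<longleftrightarrow>
     (\<forall>(s :: nat \<Rightarrow> 'a) V.
        range s \<subseteq> topspace X \<and> limitin X s x sequentially \<and> neighbourhood_in X x V \<longrightarrow>
        (\<exists>N\<in>\<N>. x \<in> N \<and> N \<subseteq> V \<and> infinite {n. s n \<in> N}))"

text \<open>At an isolated point the second disjunct holds for every family, since no set
  accumulates there.\<close>

definition cp_network_at :: "'a topology \<Rightarrow> 'a \<Rightarrow> 'a set set \<Rightarrow> bool" where
  "cp_network_at X x \<N> \<longleftrightarrow>
     (openin X {x} \<and> {x} \<in> \<N>) \<or>
     (\<forall>A V. A \<subseteq> topspace X \<and> x \<in> X closure_of A - A \<and> neighbourhood_in X x V \<longrightarrow>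
        (\<exists>N\<in>\<N>. x \<in> N \<and> N \<subseteq> V \<and> infinite (N \<inter> A)))"

datatype network_kind = CK | CS | CS_star | CP | CN | Zero

primrec network_at :: "network_kind \<Rightarrow> 'a topology \<Rightarrow> 'a \<Rightarrow> 'a set set \<Rightarrow> bool" where
  "network_at CK = ck_network_at"
| "network_at CS = cs_network_at"
| "network_at CS_star = cs_star_network_at"
| "network_at CP = cp_network_at"
| "network_at CN = cn_network_at"
| "network_at Zero = zero_network_at"

definition network_in :: "network_kind \<Rightarrow> 'a topology \<Rightarrow> 'a set set \<Rightarrow> bool" where
  "network_in \<nn> X \<N> \<longleftrightarrow> \<N> \<subseteq> Pow (topspace X) \<and> (\<forall>x\<in>topspace X. network_at \<nn> X x \<N>)"

definition sigma_locally_finite_in :: "'a topology \<Rightarrow> 'a set set \<Rightarrow> bool" where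
  "sigma_locally_finite_in X \<N> \<longleftrightarrow>
     (\<exists>\<A> :: nat \<Rightarrow> 'a set set. (\<forall>i. locally_finite_in X (\<A> i)) \<and> \<N> = (\<Union>i. \<A> i))"

text \<open>Regularity includes the Hausdorff axiom, in force for all spaces here.\<close>

definition sigma_space :: "network_kind \<Rightarrow> 'a topology \<Rightarrow> bool" where
  "sigma_space \<nn> X \<longleftrightarrow>
     Hausdorff_space X \<and> regular_space X \<and>
     (\<exists>\<N>. network_in \<nn> X \<N> \<and> sigma_locally_finite_in X \<N>)"

text \<open>Cardinals are cardinal well-orders, compared up to isomorphism. The choice below picks
  a representative of the smallest cardinal in a nonempty class.\<close>

definition least_cardinal :: "'b rel set \<Rightarrow> 'b rel" where
  "least_cardinal R = (SOME r. r \<in> R \<and> (\<forall>r'\<in>R. r \<le>o r'))"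

lemma least_cardinal:
  assumes "R \<noteq> {}" "\<forall>r\<in>R. Card_order r"
  shows "least_cardinal R \<in> R" "r \<in> R \<Longrightarrow> least_cardinal R \<le>o r"
proof -
  have "\<exists>r. r \<in> R \<and> (\<forall>r'\<in>R. r \<le>o r')"
    using exists_minim_Card_order[OF assms] by blast
  from someI_ex[OF this] show "least_cardinal R \<in> R" "r \<in> R \<Longrightarrow> least_cardinal R \<le>o r"
    unfolding least_cardinal_def by blast+
qed

definition sup_cardinal :: "'b rel set \<Rightarrow> 'b rel" where
  "sup_cardinal R = least_cardinal {k. Card_order k \<and> (\<forall>r\<in>R. r \<le>o k)}"

text \<open>An upper bound on the same type always exists, so this is a genuine supremum.\<close>

lemma sup_cardinal:
  fixes R :: "'b rel set"
  assumes "\<forall>r\<in>R. Card_order r"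
  shows "Card_order (sup_cardinal R)"
    and "r \<in> R \<Longrightarrow> r \<le>o sup_cardinal R"
    and "Card_order k \<Longrightarrow> \<forall>r\<in>R. r \<le>o k \<Longrightarrow> sup_cardinal R \<le>o (k :: 'b rel)"
proof -
  let ?S = "{k :: 'b rel. Card_order k \<and> (\<forall>r\<in>R. r \<le>o k)}"
  have "r \<le>o |UNIV :: 'b set|" if "r \<in> R" for r
  proof -
    have "|Field r| =o r" using assms that card_of_Field_ordIso by blast
    moreover have "|Field r| \<le>o |UNIV :: 'b set|" by (simp add: card_of_mono1)
    ultimately show ?thesis using ordIso_ordLeq_trans ordIso_symmetric by blast
  qed
  then have "|UNIV :: 'b set| \<in> ?S" by (simp add: card_of_Card_order)
  then have ne: "?S \<noteq> {}" by blast
  have co: "\<forall>r\<in>?S. Card_order r" by blast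
  note least = least_cardinal[OF ne co, folded sup_cardinal_def]
  show "Card_order (sup_cardinal R)" "r \<in> R \<Longrightarrow> r \<le>o sup_cardinal R"
    using least(1) by blast+
  show "sup_cardinal R \<le>o k" if "Card_order k" "\<forall>r\<in>R. r \<le>o k"
    using least(2) that by blast
qed

definition network_character_at ::
    "network_kind \<Rightarrow> 'a topology \<Rightarrow> 'a \<Rightarrow> 'a set rel" where
  "network_character_at \<nn> X x =
     least_cardinal {|\<N>| |\<N>. \<N> \<subseteq> Pow (topspace X) \<and> network_at \<nn> X x \<N>}"

definition network_character :: "network_kind \<Rightarrow> 'a topology \<Rightarrow> 'a set rel" where
  "network_character \<nn> X = sup_cardinal (network_character_at \<nn> X ` topspace X)"

end

theory Submission
  imports Defs "HOL-Library.Countable_Set_Type"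
begin

text \<open>For each of the six kinds, being a network at \<open>x\<close> depends only on the members
  containing \<open>x\<close>, and \<open>x\<close> lies in only finitely many members of a locally finite family.\<close>

lemma network_at_members_containing:
  assumes "network_at \<nn> X x \<N>"
  shows "network_at \<nn> X x {N \<in> \<N>. x \<in> N}"
proof -
  \<comment> \<open>Handles the kinds whose definition already asks for a member through
    \<open>x\<close>: the restriction repeats that demand.\<close>
  have bex: "(\<exists>N\<in>{N \<in> \<N>. x \<in> N}. x \<in> N \<and> Q N) \<longleftrightarrow> (\<exists>N\<in>\<N>. x \<in> N \<and> Q N)" for Q
    by blast
  show ?thesis
  proof (cases \<nn>)
    case CK
    \<comment> \<open>Since \<open>x\<close> lies in the intersection of \<F>, the finite subfamily
      that serves for \<N> survives the restriction unchanged.\<close>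
    have "\<F> \<subseteq> {N \<in> \<N>. x \<in> N}" if "x \<in> \<Inter>\<F>" "\<F> \<subseteq> \<N>" for \<F>
      using that by blast
    then show ?thesis
      using assms unfolding CK network_at.simps ck_network_at_def by meson
  next
    case CS
    \<comment> \<open>The chosen member contains \<open>{x}\<close> together with a tail of the
      sequence, hence contains \<open>x\<close>.\<close>
    show ?thesis
      using assms
      unfolding CS network_at.simps cs_network_at_def mem_Collect_eq bex_simps Un_subset_iff
        insert_subset by meson
  next
    case CS_star
    show ?thesis
      using assms unfolding CS_star network_at.simps cs_star_network_at_def bex .
  next
    case CP
    \<comment> \<open>The isolated alternative survives because \<open>{x}\<close> itself contains
      \<open>x\<close>.\<close>
    show ?thesis
      using assms unfolding CP network_at.simps cp_network_at_def bex by simp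
  next
    case CN
    have "{N \<in> {N \<in> \<N>. x \<in> N}. x \<in> N \<and> N \<subseteq> V} = {N \<in> \<N>. x \<in> N \<and> N \<subseteq> V}" for V
      by blast
    then show ?thesis
      using assms unfolding CN network_at.simps cn_network_at_def by simp
  next
    case Zero
    show ?thesis
      using assms unfolding Zero network_at.simps zero_network_at_def bex .
  qed
qed

lemma locally_finite_in_finite_containing:
  assumes "locally_finite_in X \<A>" "x \<in> topspace X"
  shows "finite {A \<in> \<A>. x \<in> A}"
proof -
  obtain V where V: "x \<in> V" "finite {A \<in> \<A>. A \<inter> V \<noteq> {}}"
    using assms unfolding locally_finite_in_def by blast
  show ?thesis
    by (rule finite_subset[OF _ V(2)]) (use V(1) in blast)
qed

lemma sigma_locally_finite_in_countable_containing:
  assumes "sigma_locally_finite_in X \<N>" "x \<in> topspace X"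
  shows "countable {N \<in> \<N>. x \<in> N}"
proof -
  obtain \<A> :: "nat \<Rightarrow> 'a set set"
    where \<A>: "\<And>i. locally_finite_in X (\<A> i)" "\<N> = (\<Union>i. \<A> i)"
    using assms(1) unfolding sigma_locally_finite_in_def by blast
  have "{N \<in> \<N>. x \<in> N} = (\<Union>i. {N \<in> \<A> i. x \<in> N})"
    using \<A>(2) by blast
  then show ?thesis
    using locally_finite_in_finite_containing[OF \<A>(1) assms(2)]
    by (simp add: countable_finite)
qed

text \<open>A network at \<open>x\<close> makes the class of candidate cardinals nonempty; only then
  does the choice in \<open>least_cardinal\<close> yield an actual minimum.\<close>

lemma network_character_at:
  assumes "\<N> \<subseteq> Pow (topspace X)" "network_at \<nn> X x \<N>"
  shows "Card_order (network_character_at \<nn> X x)"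
    and "network_character_at \<nn> X x \<le>o |\<N>|"
proof -
  let ?R = "{|\<N>| |\<N>. \<N> \<subseteq> Pow (topspace X) \<and> network_at \<nn> X x \<N>}"
  have mem: "|\<N>| \<in> ?R"
    using assms by blast
  have "?R \<noteq> {}" "\<forall>r\<in>?R. Card_order r"
    using mem by (blast, auto simp: card_of_Card_order)
  note least = least_cardinal[OF this, folded network_character_at_def]
  show "Card_order (network_character_at \<nn> X x)"
    using least(1) by (auto simp: card_of_Card_order)
  show "network_character_at \<nn> X x \<le>o |\<N>|"
    using least(2)[OF mem] .
qed

text \<open>The supremum is taken among cardinals on \<open>'b\<close>, which represent \<open>natLeq\<close>
  only if it is infinite.\<close>

lemma sup_cardinal_le_natLeq:
  fixes R :: "'b rel set"
  assumes card: "\<forall>r\<in>R. Card_order r" and le: "\<forall>r\<in>R. r \<le>o natLeq"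
  shows "sup_cardinal R \<le>o natLeq"
proof (cases "finite (UNIV :: 'b set)")
  case True
  \<comment> \<open>Every cardinal in \<open>R\<close> lives on a subset of the type, so the whole
    type is an upper bound, and a finite one here.\<close>
  have "r \<le>o |UNIV :: 'b set|" if "r \<in> R" for r
  proof -
    have "r =o |Field r|"
      using card that card_of_Field_ordIso ordIso_symmetric by blast
    then show ?thesis
      using card_of_mono1[OF subset_UNIV] ordIso_ordLeq_trans by blast
  qed
  then have "sup_cardinal R \<le>o |UNIV :: 'b set|"
    by (intro sup_cardinal(3)[OF card card_of_Card_order]) blast
  also have "|UNIV :: 'b set| \<le>o natLeq"
    using True by (simp add: countable_card_le_natLeq[symmetric] countable_finite)
  finally show ?thesis .
next
  case False
  \<comment> \<open>Minimality of the supremum applies only to bounds on \<open>'b\<close>, so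
    \<open>natLeq\<close> is replaced by its copy on the range of an injection.\<close>
  then obtain f :: "nat \<Rightarrow> 'b" where "inj f"
    using infinite_countable_subset by blast
  then have "|UNIV :: nat set| =o |range f|"
    using card_of_ordIso inj_on_imp_bij_betw by blast
  then have iso: "natLeq =o |range f|"
    using card_of_nat ordIso_symmetric ordIso_transitive by blast
  then have "sup_cardinal R \<le>o |range f|"
    using sup_cardinal(3)[OF card card_of_Card_order] le ordLeq_ordIso_trans by blast
  then show ?thesis
    using iso ordIso_symmetric ordLeq_ordIso_trans by blast
qed

theorem corollary3p7:
  fixes X :: "'a topology" and \<nn> :: network_kind
  assumes "sigma_space \<nn> X"
  shows "network_character \<nn> X \<le>o natLeq"
proof -
  obtain \<N> where \<N>: "network_in \<nn> X \<N>" "sigma_locally_finite_in X \<N>"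
    using assms unfolding sigma_space_def by blast
  have "Card_order (network_character_at \<nn> X x)"
    and "network_character_at \<nn> X x \<le>o natLeq" if x: "x \<in> topspace X" for x
  proof -
    have "\<N> \<subseteq> Pow (topspace X)" "network_at \<nn> X x \<N>"
      using \<N>(1) x unfolding network_in_def by simp_all
    \<comment> \<open>\<N> itself may be uncountable, so the network used to bound the character at
      \<open>x\<close> is its part through \<open>x\<close>.\<close>
    then have net: "{N \<in> \<N>. x \<in> N} \<subseteq> Pow (topspace X)" "network_at \<nn> X x {N \<in> \<N>. x \<in> N}"
      by (auto intro: network_at_members_containing)
    show "Card_order (network_character_at \<nn> X x)"
      using network_character_at(1)[OF net] .
    have "|{N \<in> \<N>. x \<in> N}| \<le>o natLeq"
      using sigma_locally_finite_in_countable_containing[OF \<N>(2) x]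
      by (simp add: countable_card_le_natLeq)
    then show "network_character_at \<nn> X x \<le>o natLeq"
      using network_character_at(2)[OF net] ordLeq_transitive by blast
  qed
  then show ?thesis
    unfolding network_character_def by (intro sup_cardinal_le_natLeq) auto
qed

end
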